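(* Suppose that $\mathbf{C}=\mathbf{A}\cdot\mathbf{B}$, with $\mathbf A\in\mathbb R^{M\times K}$ and $\mathbf B\in\mathbb R^{K\times N}$, is computed by a uniform, non-stationary algorithm with $L$ recursive steps of fast matrix multiplication, with the bilinear algorithm $[\![\mathbf U^{[l]},\mathbf V^{[l]},\mathbf W^{[l]}]\!]$ (base case $\langle M_0^{[l]},K_0^{[l]},N_0^{[l]}\rangle$, rank $R^{[l]}$, prefactor $Q^{[l]}$, stability factor $E^{[l]}$) used at level $l$, $l=1,\dots,L$, and the classical algorithm used to multiply the matrices at the base case of the recursion (where $M,K,N$ are divisible by $\prod_{l}M_0^{[l]}$, $\prod_{l}K_0^{[l]}$, $\prod_{l}N_0^{[l]}$ respectively). Then the computed matrix $\hat{\mathbf{C}}$ satisfies $$\|\hat{\mathbf{C}}-\mathbf{C}\|\le\left(\frac{K}{\prod_{l=1}^{L}K_0^{[l]}}+\sum_{l=1}^{L}Q^{[l]}\right)\left(\frac{K}{\prod_{l=1}^{L}K_0^{[l]}}\right)\cdot\left(\prod_{l=1}^{L}E^{[l]}\right)\|\mathbf{A}\|\,\|\mathbf{B}\|\,\epsilon+O(\epsilon^2),$$ where $\|\cdot\|$ is the max-norm.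
   Context: Max-norm: $\|\mathbf X\|=\max_{i,j}|x_{ij}|$. Bilinear algorithm: a (non-commutative) bilinear algorithm $[\![\mathbf U,\mathbf V,\mathbf W]\!]$ with base case $\langle M_0,K_0,N_0\rangle$ and rank $R$ is given by real matrices $\mathbf U$ ($M_0K_0\times R$), $\mathbf V$ ($K_0N_0\times R$), $\mathbf W$ ($M_0N_0\times R$) such that, for every $M_0\times K_0$ matrix $\mathbf A$ and $K_0\times N_0$ matrix $\mathbf B$ (with entries possibly non-commuting, e.g. matrix blocks), the product $\mathbf C=\mathbf A\mathbf B$ is given by $$c_k=\sum_{r=1}^R w_{kr}m_r,\quad m_r=s_r\cdot t_r,\quad s_r=\sum_{i=1}^{M_0K_0}u_{ir}a_i,\quad t_r=\sum_{j=1}^{K_0N_0}v_{jr}b_j,\qquad k=1,\dots,M_0N_0,$$ where single indices of entries of $\mathbf A$ and $\mathbf B$ are in column-major order and single indices of entries of $\mathbf C$ are in row-major order. Uniform, non-stationary algorithm: at recursion level $l$, every subproblem $\mathbf A\mathbf B$ is handled by partitioning $\mathbf A$ into $M_0^{[l]}\times K_0^{[l]}$ equally sized blocks and $\mathbf B$ into $K_0^{[l]}\times N_0^{[l]}$ equally sized blocks and applying the formulas above for $[\![\mathbf U^{[l]},\mathbf V^{[l]},\mathbf W^{[l]}]\!]$ with blocks in place of entries; the $R^{[l]}$ block products $\mathbf M_r=\mathbf S_r\cdot\mathbf T_r$ are the subproblems at level $l+1$. The same rule is used for all subproblems at a given level, but rules may differ across levels. After $L$ levels, products are computed by the classical algorithm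 (each output entry is an inner product accumulated by sequential summation). Arithmetic model: each scalar operation is computed with relative error less than $\epsilon$ (machine precision), i.e. the computed value of $\mathrm{op}(a,b)$ is $\mathrm{op}(a,b)(1+\theta)$ with $|\theta|<\epsilon$; this includes multiplications by entries of $\mathbf U^{[l]},\mathbf V^{[l]},\mathbf W^{[l]}$. All sums (over terms with nonzero coefficients) are accumulated one term at a time in sequential order. A hat denotes a computed quantity. The term $O(\epsilon^2)$ is as $\epsilon\to0$ and hides dependence on dimensions, the algorithms, and the norms of the input matrices. Principal quantities of an algorithm $[\![\mathbf U,\mathbf V,\mathbf W]\!]$: with $\mathbb I$ the indicator function, $$\alpha_r=\sum_{i}\mathbb I(u_{ir}\ne0),\quad \beta_r=\sum_j\mathbb I(v_{jr}\neq0),\quad \gamma_k=\sum_{r=1}^R\mathbb I(w_{kr}\ne0),\quad a_r=\sum_i|u_{ir}|,\quad b_r=\sum_j|v_{jr}|.$$ The prefactor is $Q=\max_k q_k$ with $q_k=\gamma_k+\max_r(\alpha_r+\beta_r)\,\mathbb I(w_{kr}\neq0)$. The stability factor is $E=\max_k e_k$ with $e_k=\sum_{r=1}^R a_r\, b_r\,|w_{kr}|$. Here $k$ ranges over $1,\dots,M_0N_0$. $Q^{[l]}$ and $E^{[l]}$ denote these quantities for $[\![\mathbf U^{[l]},\mathbf V^{[l]},\mathbf W^{[l]}]\!]$. *)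

theory Defs
  imports "Jordan_Normal_Form.Matrix" "HOL-Library.Landau_Symbols"
begin

text \<open>All matrix and block indices start at 0; recursion levels are numbered from 1.\<close>

definition max_norm :: "real mat \<Rightarrow> real" where
  "max_norm X = Max {\<bar>X $$ (i, j)\<bar> | i j. i < dim_row X \<and> j < dim_col X}"

text \<open>Block \<open>(i, j)\<close> of \<open>X\<close> partitioned into a \<open>p\<close> by \<open>q\<close> grid of equally sized blocks
  (meaningful when \<open>p\<close> and \<open>q\<close> divide the dimensions of \<open>X\<close>), and the same blocks
  enumerated by a single index in column-major and in row-major order.\<close>

definition block :: "nat \<Rightarrow> nat \<Rightarrow> real mat \<Rightarrow> nat \<Rightarrow> nat \<Rightarrow> real mat" where
  "block p q X i j = (let m = dim_row X div p; n = dim_col X div q in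
     mat m n (\<lambda>(i', j'). X $$ (i * m + i', j * n + j')))"

definition block_col_major :: "nat \<Rightarrow> nat \<Rightarrow> real mat \<Rightarrow> nat \<Rightarrow> real mat" where
  "block_col_major p q X i = block p q X (i mod p) (i div p)"

definition block_row_major :: "nat \<Rightarrow> nat \<Rightarrow> real mat \<Rightarrow> nat \<Rightarrow> real mat" where
  "block_row_major p q X k = block p q X (k div q) (k mod q)"


section \<open>Bilinear algorithms\<close>

record bilinear =
  base_M :: nat
  base_K :: nat
  base_N :: nat
  rk :: nat
  mat_U :: "real mat"
  mat_V :: "real mat"
  mat_W :: "real mat"

definition lincomb_mat ::
  "nat \<Rightarrow> nat \<Rightarrow> nat \<Rightarrow> (nat \<Rightarrow> real) \<Rightarrow> (nat \<Rightarrow> real mat) \<Rightarrow> real mat" where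
  "lincomb_mat m n len c X = mat m n (\<lambda>(i, j). \<Sum>l<len. c l * X l $$ (i, j))"

text \<open>The non-commuting entries of the base case range over real matrix blocks of arbitrary
  sizes (\<open>p\<close> by \<open>q\<close> in the left factor, \<open>q\<close> by \<open>s\<close> in the right factor), as in the recursive
  use of the algorithm; \<open>p = q = s = 1\<close> is the case of real entries.\<close>

definition bilinear_algorithm :: "bilinear \<Rightarrow> bool" where
  "bilinear_algorithm F \<longleftrightarrow>
     0 < base_M F \<and> 0 < base_K F \<and> 0 < base_N F \<and>
     mat_U F \<in> carrier_mat (base_M F * base_K F) (rk F) \<and>
     mat_V F \<in> carrier_mat (base_K F * base_N F) (rk F) \<and>
     mat_W F \<in> carrier_mat (base_M F * base_N F) (rk F) \<and>
     (\<forall>p q s. \<forall>A \<in> carrier_mat (base_M F * p) (base_K F * q).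
              \<forall>B \<in> carrier_mat (base_K F * q) (base_N F * s).
       let S = (\<lambda>r. lincomb_mat p q (base_M F * base_K F) (\<lambda>i. mat_U F $$ (i, r))
                      (block_col_major (base_M F) (base_K F) A));
           T = (\<lambda>r. lincomb_mat q s (base_K F * base_N F) (\<lambda>j. mat_V F $$ (j, r))
                      (block_col_major (base_K F) (base_N F) B))
       in \<forall>k < base_M F * base_N F.
            block_row_major (base_M F) (base_N F) (A * B) k =
            lincomb_mat p s (rk F) (\<lambda>r. mat_W F $$ (k, r)) (\<lambda>r. S r * T r))"


section \<open>Principal quantities\<close>

definition alpha_count :: "bilinear \<Rightarrow> nat \<Rightarrow> nat" where
  "alpha_count F r = (\<Sum>i < base_M F * base_K F. of_bool (mat_U F $$ (i, r) \<noteq> 0))"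

definition beta_count :: "bilinear \<Rightarrow> nat \<Rightarrow> nat" where
  "beta_count F r = (\<Sum>j < base_K F * base_N F. of_bool (mat_V F $$ (j, r) \<noteq> 0))"

definition gamma_count :: "bilinear \<Rightarrow> nat \<Rightarrow> nat" where
  "gamma_count F k = (\<Sum>r < rk F. of_bool (mat_W F $$ (k, r) \<noteq> 0))"

definition a_sum :: "bilinear \<Rightarrow> nat \<Rightarrow> real" where
  "a_sum F r = (\<Sum>i < base_M F * base_K F. \<bar>mat_U F $$ (i, r)\<bar>)"

definition b_sum :: "bilinear \<Rightarrow> nat \<Rightarrow> real" where
  "b_sum F r = (\<Sum>j < base_K F * base_N F. \<bar>mat_V F $$ (j, r)\<bar>)"

definition prefactor :: "bilinear \<Rightarrow> nat" where
  "prefactor F = (MAX k \<in> {..<base_M F * base_N F}. gamma_count F k +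
     (MAX r \<in> {..<rk F}. (alpha_count F r + beta_count F r) * of_bool (mat_W F $$ (k, r) \<noteq> 0)))"

definition stability_factor :: "bilinear \<Rightarrow> real" where
  "stability_factor F = (MAX k \<in> {..<base_M F * base_N F}.
     \<Sum>r < rk F. a_sum F r * b_sum F r * \<bar>mat_W F $$ (k, r)\<bar>)"


section \<open>Computation with rounding errors\<close>

text \<open>The predicates below relate inputs to every output that some choice of the individual
  rounding errors can produce; errors of different operations are independent.\<close>

definition rounded :: "real \<Rightarrow> real \<Rightarrow> real \<Rightarrow> bool" where
  "rounded \<epsilon> x y \<longleftrightarrow> (\<exists>\<theta>. \<bar>\<theta>\<bar> < \<epsilon> \<and> y = x * (1 + \<theta>))"

fun fl_accumulate :: "real \<Rightarrow> real \<Rightarrow> real list \<Rightarrow> real \<Rightarrow> bool" where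
  "fl_accumulate \<epsilon> s [] y \<longleftrightarrow> y = s"
| "fl_accumulate \<epsilon> s (x # xs) y \<longleftrightarrow> (\<exists>s'. rounded \<epsilon> (s + x) s' \<and> fl_accumulate \<epsilon> s' xs y)"

text \<open>Summing \<open>n\<close> terms takes \<open>n - 1\<close> additions; an empty sum is exactly 0.\<close>

fun fl_sum :: "real \<Rightarrow> real list \<Rightarrow> real \<Rightarrow> bool" where
  "fl_sum \<epsilon> [] y \<longleftrightarrow> y = 0"
| "fl_sum \<epsilon> (x # xs) y \<longleftrightarrow> fl_accumulate \<epsilon> x xs y"

definition fl_sum_prod :: "real \<Rightarrow> nat list \<Rightarrow> (nat \<Rightarrow> real) \<Rightarrow> (nat \<Rightarrow> real) \<Rightarrow> real \<Rightarrow> bool" where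
  "fl_sum_prod \<epsilon> is c x y \<longleftrightarrow>
     (\<exists>ps. list_all2 (\<lambda>i p. rounded \<epsilon> (c i * x i) p) is ps \<and> fl_sum \<epsilon> ps y)"

definition fl_lincomb_mat ::
  "real \<Rightarrow> nat \<Rightarrow> nat \<Rightarrow> nat \<Rightarrow> (nat \<Rightarrow> real) \<Rightarrow> (nat \<Rightarrow> real mat) \<Rightarrow> real mat \<Rightarrow> bool" where
  "fl_lincomb_mat \<epsilon> m n len c X Y \<longleftrightarrow> Y \<in> carrier_mat m n \<and>
     (\<forall>i<m. \<forall>j<n.
        fl_sum_prod \<epsilon> (filter (\<lambda>l. c l \<noteq> 0) [0..<len]) c (\<lambda>l. X l $$ (i, j)) (Y $$ (i, j)))"

definition fl_classical :: "real \<Rightarrow> real mat \<Rightarrow> real mat \<Rightarrow> real mat \<Rightarrow> bool" where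
  "fl_classical \<epsilon> A B C \<longleftrightarrow> C \<in> carrier_mat (dim_row A) (dim_col B) \<and>
     (\<forall>i<dim_row A. \<forall>j<dim_col B.
        fl_sum_prod \<epsilon> [0..<dim_col A] (\<lambda>l. A $$ (i, l)) (\<lambda>l. B $$ (l, j)) (C $$ (i, j)))"

text \<open>\<open>fl_fast_mult \<epsilon> Fs A B C\<close>: \<open>C\<close> is a possible computed value of \<open>A * B\<close>, where the list
  \<open>Fs\<close> gives the algorithms for the successive recursion levels, outermost first.\<close>

fun fl_fast_mult ::
  "real \<Rightarrow> bilinear list \<Rightarrow> real mat \<Rightarrow> real mat \<Rightarrow> real mat \<Rightarrow> bool" where
  "fl_fast_mult \<epsilon> [] A B C \<longleftrightarrow> fl_classical \<epsilon> A B C"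
| "fl_fast_mult \<epsilon> (F # Fs) A B C \<longleftrightarrow>
     C \<in> carrier_mat (dim_row A) (dim_col B) \<and>
     (let m = dim_row A div base_M F; h = dim_col A div base_K F; n = dim_col B div base_N F in
      \<exists>S T P :: nat \<Rightarrow> real mat.
        (\<forall>r < rk F.
           fl_lincomb_mat \<epsilon> m h (base_M F * base_K F) (\<lambda>i. mat_U F $$ (i, r))
             (block_col_major (base_M F) (base_K F) A) (S r) \<and>
           fl_lincomb_mat \<epsilon> h n (base_K F * base_N F) (\<lambda>j. mat_V F $$ (j, r))
             (block_col_major (base_K F) (base_N F) B) (T r) \<and>
           fl_fast_mult \<epsilon> Fs (S r) (T r) (P r)) \<and>
        (\<forall>k < base_M F * base_N F.
           fl_lincomb_mat \<epsilon> m n (rk F) (\<lambda>r. mat_W F $$ (k, r)) P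
             (block_row_major (base_M F) (base_N F) C k)))"

end

theory Submission
  imports Defs
begin

text \<open>
  A term passing through a sequential sum of \<open>n\<close> rounded products collects at most \<open>n\<close> factors
  \<open>1 + \<theta>\<close>, so the error is at most \<open>(1 + \<epsilon>)\<^sup>n - 1\<close> times the sum of the absolute values.
  By induction on the recursion depth the same holds for the whole algorithm with exponent
  \<open>p = H + \<Sum> Q\<close>, where \<open>H = K / \<Prod> K\<^sub>0\<close>, and scale \<open>H (\<Prod> E) \<parallel>A\<parallel> \<parallel>B\<parallel>\<close>; this bound is valid for every
  \<open>\<epsilon> > 0\<close>, and its linear part is the claim.  Perturbing the factors of a subproblem of inner
  dimension \<open>h\<close> costs a multiple of \<open>h\<close>, not of \<open>H\<close>; this is absorbed by the remaining stability
  factors, because \<open>E \<ge> K\<^sub>0\<close> for every correct bilinear algorithm.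
\<close>

section \<open>Rounding errors of sequential sums\<close>

lemma rounded_error:
  assumes "rounded \<epsilon> x y"
  shows "\<bar>y - x\<bar> \<le> \<epsilon> * \<bar>x\<bar>"
proof -
  from assms obtain \<theta> where th: "\<bar>\<theta>\<bar> < \<epsilon>" "y = x * (1 + \<theta>)"
    by (auto simp: rounded_def)
  have "\<bar>y - x\<bar> = \<bar>\<theta>\<bar> * \<bar>x\<bar>"
    by (simp add: th algebra_simps abs_mult)
  also have "\<dots> \<le> \<epsilon> * \<bar>x\<bar>"
    using th by (intro mult_right_mono) auto
  finally show ?thesis .
qed

text \<open>No term is hit by more roundings than there are additions, so all terms, including the
  start value \<open>s\<close>, share the exponent \<open>length xs\<close>. The start value is
  generalised in the induction because the first addition replaces it by \<open>s'\<close>.\<close>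

lemma fl_accumulate_error:
  assumes "0 \<le> \<epsilon>" "fl_accumulate \<epsilon> s xs y"
  shows "\<bar>y - (s + sum_list xs)\<bar>
    \<le> ((1 + \<epsilon>) ^ length xs - 1) * (\<bar>s\<bar> + (\<Sum>x\<leftarrow>xs. \<bar>x\<bar>))"
  using assms(2)
proof (induction xs arbitrary: s)
  case Nil
  then show ?case by simp
next
  case (Cons x xs)
  then obtain s' where s': "rounded \<epsilon> (s + x) s'" "fl_accumulate \<epsilon> s' xs y" by auto
  let ?d = "(1 + \<epsilon>) ^ length xs" and ?S = "\<Sum>x\<leftarrow>xs. \<bar>x\<bar>" and ?t = "\<bar>s\<bar> + \<bar>x\<bar>"
  have d: "1 \<le> ?d" using assms(1) by (simp add: one_le_power)
  have S: "0 \<le> ?S" by (rule sum_list_nonneg) auto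
  have "\<epsilon> * \<bar>s + x\<bar> \<le> \<epsilon> * ?t" using assms(1) by (intro mult_left_mono) auto
  then have e: "\<bar>s' - (s + x)\<bar> \<le> \<epsilon> * ?t"
    using rounded_error[OF s'(1)] by linarith
  then have "\<bar>s'\<bar> \<le> (1 + \<epsilon>) * ?t" by (simp add: algebra_simps)
  then have "(?d - 1) * (\<bar>s'\<bar> + ?S) \<le> (?d - 1) * ((1 + \<epsilon>) * ?t + ?S)"
    using d by (intro mult_left_mono) auto
  then have "\<bar>y - (s + sum_list (x # xs))\<bar> \<le> (?d - 1) * ((1 + \<epsilon>) * ?t + ?S) + \<epsilon> * ?t"
    using Cons.IH[OF s'(2)] e unfolding sum_list.Cons by linarith
  also have "\<dots> = ((1 + \<epsilon>) * ?d - 1) * ?t + (?d - 1) * ?S" by (simp add: algebra_simps)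
  \<comment> \<open>The later terms in \<open>?S\<close> miss the first rounding; their smaller
    factor is raised to that of \<open>s\<close> and \<open>x\<close>.\<close>
  also have "\<dots> \<le> ((1 + \<epsilon>) * ?d - 1) * ?t + ((1 + \<epsilon>) * ?d - 1) * ?S"
    using S d assms(1) by (intro add_left_mono mult_right_mono) (auto simp: algebra_simps)
  finally show ?case by (simp add: algebra_simps)
qed

text \<open>Each of the \<open>n\<close> terms is rounded once as a product and then at most
  \<open>n - 1\<close> times in additions, hence the exponent \<open>n\<close>.\<close>

lemma fl_sum_prod_error:
  assumes "0 \<le> \<epsilon>" "fl_sum_prod \<epsilon> is c x y"
  shows "\<bar>y - (\<Sum>i\<leftarrow>is. c i * x i)\<bar>
    \<le> ((1 + \<epsilon>) ^ length is - 1) * (\<Sum>i\<leftarrow>is. \<bar>c i * x i\<bar>)"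
proof -
  from assms(2) obtain ps where
    ps: "list_all2 (\<lambda>i p. rounded \<epsilon> (c i * x i) p) is ps" and y: "fl_sum \<epsilon> ps y"
    by (auto simp: fl_sum_prod_def)
  let ?S = "\<Sum>i\<leftarrow>is. \<bar>c i * x i\<bar>"
  from ps have e: "\<bar>sum_list ps - (\<Sum>i\<leftarrow>is. c i * x i)\<bar> \<le> \<epsilon> * ?S"
    and b: "(\<Sum>p\<leftarrow>ps. \<bar>p\<bar>) \<le> (1 + \<epsilon>) * ?S"
    by (induction rule: list_all2_induct)
      (force dest!: rounded_error simp: algebra_simps)+
  have len: "length is = length ps" using ps by (rule list_all2_lengthD)
  show ?thesis
  \<comment> \<open>The first product starts the accumulation without an addition, so there are
    \<open>length qs\<close> additions, one less than the number of terms. The empty sum is exactly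
    0.\<close>
  proof (cases ps)
    case Nil
    then show ?thesis using y len by simp
  next
    case (Cons p qs)
    let ?d = "(1 + \<epsilon>) ^ length qs"
    have d: "1 \<le> ?d" using assms(1) by (simp add: one_le_power)
    have "\<bar>y - sum_list ps\<bar> \<le> (?d - 1) * (\<Sum>p\<leftarrow>ps. \<bar>p\<bar>)"
      using fl_accumulate_error[OF assms(1), of p qs y] y Cons by simp
    also have "\<dots> \<le> (?d - 1) * ((1 + \<epsilon>) * ?S)"
      using d b by (intro mult_left_mono) auto
    finally have "\<bar>y - (\<Sum>i\<leftarrow>is. c i * x i)\<bar> \<le> (?d - 1) * ((1 + \<epsilon>) * ?S) + \<epsilon> * ?S"
      using e by linarith
    also have "\<dots> = ((1 + \<epsilon>) ^ length is - 1) * ?S"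
      using len Cons by (simp add: algebra_simps)
    finally show ?thesis .
  qed
qed

section \<open>Errors of linear combinations and of the classical product\<close>

lemma sum_list_filter_upt:
  "(\<Sum>l\<leftarrow>filter P [0..<n]. f l) = (\<Sum>l<n. if P l then f l else 0)"
  by (simp add: sum_list_map_filter' interv_sum_list_conv_sum_set_nat atLeast0LessThan)

lemma length_filter_upt: "length (filter P [0..<n]) = (\<Sum>l<n. of_bool (P l))"
  by (induction n) auto

text \<open>Zero coefficients cause no operations, so the exponent counts the nonzero ones only;
  this is the source of \<open>alpha_count\<close>, \<open>beta_count\<close> and
  \<open>gamma_count\<close>. The entries of \<open>X l\<close> are kept in the bound because the
  block products summed with \<open>mat_W\<close> have no useful common bound.\<close>

lemma fl_lincomb_mat_error:
  assumes "0 \<le> \<epsilon>" "fl_lincomb_mat \<epsilon> m n len c X Y" "i < m" "j < n"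
  shows "\<bar>Y $$ (i, j) - (\<Sum>l<len. c l * X l $$ (i, j))\<bar>
    \<le> ((1 + \<epsilon>) ^ (\<Sum>l<len. of_bool (c l \<noteq> 0)) - 1) * (\<Sum>l<len. \<bar>c l\<bar> * \<bar>X l $$ (i, j)\<bar>)"
proof -
  have "fl_sum_prod \<epsilon> (filter (\<lambda>l. c l \<noteq> 0) [0..<len]) c (\<lambda>l. X l $$ (i, j)) (Y $$ (i, j))"
    using assms by (auto simp: fl_lincomb_mat_def)
  from fl_sum_prod_error[OF assms(1) this]
  have "\<bar>Y $$ (i, j) - (\<Sum>l<len. if c l \<noteq> 0 then c l * X l $$ (i, j) else 0)\<bar>
    \<le> ((1 + \<epsilon>) ^ (\<Sum>l<len. of_bool (c l \<noteq> 0)) - 1)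
       * (\<Sum>l<len. if c l \<noteq> 0 then \<bar>c l * X l $$ (i, j)\<bar> else 0)"
    by (simp only: sum_list_filter_upt length_filter_upt)
  moreover have "(\<Sum>l<len. if c l \<noteq> 0 then c l * X l $$ (i, j) else 0)
      = (\<Sum>l<len. c l * X l $$ (i, j))"
    by (rule sum.cong) auto
  moreover have "(\<Sum>l<len. if c l \<noteq> 0 then \<bar>c l * X l $$ (i, j)\<bar> else 0)
      = (\<Sum>l<len. \<bar>c l\<bar> * \<bar>X l $$ (i, j)\<bar>)"
    by (rule sum.cong) (auto simp: abs_mult)
  ultimately show ?thesis by simp
qed

lemma fl_classical_error:
  assumes "0 \<le> \<epsilon>" "fl_classical \<epsilon> A B C" "A \<in> carrier_mat M K" "B \<in> carrier_mat K N"
    and a: "\<And>i j. i < M \<Longrightarrow> j < K \<Longrightarrow> \<bar>A $$ (i, j)\<bar> \<le> a"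
    and b: "\<And>i j. i < K \<Longrightarrow> j < N \<Longrightarrow> \<bar>B $$ (i, j)\<bar> \<le> b"
    and ij: "i < M" "j < N"
  shows "\<bar>C $$ (i, j) - (A * B) $$ (i, j)\<bar> \<le> ((1 + \<epsilon>) ^ K - 1) * (K * (a * b))"
proof -
  have "fl_sum_prod \<epsilon> [0..<K] (\<lambda>l. A $$ (i, l)) (\<lambda>l. B $$ (l, j)) (C $$ (i, j))"
    using assms by (auto simp: fl_classical_def)
  from fl_sum_prod_error[OF assms(1) this]
  have "\<bar>C $$ (i, j) - (\<Sum>l<K. A $$ (i, l) * B $$ (l, j))\<bar>
    \<le> ((1 + \<epsilon>) ^ K - 1) * (\<Sum>l<K. \<bar>A $$ (i, l) * B $$ (l, j)\<bar>)"
    by (simp add: interv_sum_list_conv_sum_set_nat atLeast0LessThan)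
  also have "(\<Sum>l<K. A $$ (i, l) * B $$ (l, j)) = (A * B) $$ (i, j)"
    using assms(3,4) ij by (auto simp: scalar_prod_def atLeast0LessThan intro!: sum.cong)
  also have "(\<Sum>l<K. \<bar>A $$ (i, l) * B $$ (l, j)\<bar>) \<le> (\<Sum>l<K. a * b)"
  proof (rule sum_mono)
    fix l assume "l \<in> {..<K}"
    then show "\<bar>A $$ (i, l) * B $$ (l, j)\<bar> \<le> a * b"
      using a[of i l] b[of l j] ij by (auto simp: abs_mult intro!: mult_mono)
  qed
  finally show ?thesis using assms(1) by (simp add: mult_left_mono one_le_power)
qed

section \<open>Exact products of bounded and of perturbed matrices\<close>

lemma mult_mat_error:
  fixes A A' B B' :: "real mat"
  assumes "A \<in> carrier_mat m h" "B \<in> carrier_mat h n" "A' \<in> carrier_mat m h" "B' \<in> carrier_mat h n"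
    and x: "1 \<le> x" and y: "1 \<le> y"
    and A: "\<And>i j. i < m \<Longrightarrow> j < h \<Longrightarrow> \<bar>A $$ (i, j)\<bar> \<le> a"
    and B: "\<And>i j. i < h \<Longrightarrow> j < n \<Longrightarrow> \<bar>B $$ (i, j)\<bar> \<le> b"
    and A': "\<And>i j. i < m \<Longrightarrow> j < h \<Longrightarrow> \<bar>A' $$ (i, j) - A $$ (i, j)\<bar> \<le> (x - 1) * a"
    and B': "\<And>i j. i < h \<Longrightarrow> j < n \<Longrightarrow> \<bar>B' $$ (i, j) - B $$ (i, j)\<bar> \<le> (y - 1) * b"
    and ij: "i < m" "j < n"
  shows "\<bar>(A' * B') $$ (i, j) - (A * B) $$ (i, j)\<bar> \<le> h * ((x * y - 1) * (a * b))"
proof -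
  have "(A' * B') $$ (i, j) - (A * B) $$ (i, j)
      = (\<Sum>l<h. A' $$ (i, l) * B' $$ (l, j) - A $$ (i, l) * B $$ (l, j))"
    using assms(1-4) ij by (simp add: scalar_prod_def atLeast0LessThan sum_subtractf)
  also have "\<bar>\<dots>\<bar> \<le> (\<Sum>l<h. \<bar>A' $$ (i, l) * B' $$ (l, j) - A $$ (i, l) * B $$ (l, j)\<bar>)"
    by (rule sum_abs)
  also have "\<dots> \<le> (\<Sum>l<h. (x * y - 1) * (a * b))"
  proof (rule sum_mono)
    fix l assume "l \<in> {..<h}"
    then have l: "l < h" by simp
    note bounds = A[OF ij(1) l] B[OF l ij(2)] A'[OF ij(1) l] B'[OF l ij(2)]
    have a: "0 \<le> a" and b: "0 \<le> b" using bounds(1,2) by linarith+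
    have B'_abs: "\<bar>B' $$ (l, j)\<bar> \<le> y * b"
      using bounds(2,4) by (simp add: algebra_simps)
    \<comment> \<open>With \<open>B'\<close> kept in the first summand, the bounds add up to
      \<open>(x - 1) * y + (y - 1) = x * y - 1\<close>: growth factors multiply, and no second-order
      term is lost.\<close>
    have "A' $$ (i, l) * B' $$ (l, j) - A $$ (i, l) * B $$ (l, j)
      = (A' $$ (i, l) - A $$ (i, l)) * B' $$ (l, j) + A $$ (i, l) * (B' $$ (l, j) - B $$ (l, j))"
      by (simp add: algebra_simps)
    also have "\<bar>\<dots>\<bar> \<le> \<bar>A' $$ (i, l) - A $$ (i, l)\<bar> * \<bar>B' $$ (l, j)\<bar>
        + \<bar>A $$ (i, l)\<bar> * \<bar>B' $$ (l, j) - B $$ (l, j)\<bar>"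
      by (metis abs_mult abs_triangle_ineq)
    also have "\<dots> \<le> ((x - 1) * a) * (y * b) + a * ((y - 1) * b)"
      using bounds B'_abs a x by (intro add_mono mult_mono) auto
    finally show "\<bar>A' $$ (i, l) * B' $$ (l, j) - A $$ (i, l) * B $$ (l, j)\<bar>
      \<le> (x * y - 1) * (a * b)" by (simp add: algebra_simps)
  qed
  finally show ?thesis by simp
qed

lemma mult_mat_bound:
  fixes A B :: "real mat"
  assumes "A \<in> carrier_mat m h" "B \<in> carrier_mat h n"
    and A: "\<And>i j. i < m \<Longrightarrow> j < h \<Longrightarrow> \<bar>A $$ (i, j)\<bar> \<le> a"
    and B: "\<And>i j. i < h \<Longrightarrow> j < n \<Longrightarrow> \<bar>B $$ (i, j)\<bar> \<le> b"
    and ij: "i < m" "j < n"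
  shows "\<bar>(A * B) $$ (i, j)\<bar> \<le> h * (a * b)"
proof -
  have "\<bar>(A * B) $$ (i, j)\<bar> = \<bar>\<Sum>l<h. A $$ (i, l) * B $$ (l, j)\<bar>"
    using assms(1,2) ij by (simp add: scalar_prod_def atLeast0LessThan)
  also have "\<dots> \<le> (\<Sum>l<h. \<bar>A $$ (i, l) * B $$ (l, j)\<bar>)"
    by (rule sum_abs)
  also have "\<dots> \<le> (\<Sum>l<h. a * b)"
  proof (rule sum_mono)
    fix l assume "l \<in> {..<h}"
    then show "\<bar>A $$ (i, l) * B $$ (l, j)\<bar> \<le> a * b"
      using A[of i l] B[of l j] ij by (auto simp: abs_mult intro!: mult_mono)
  qed
  finally show ?thesis by simp
qed

section \<open>Entries of blocks\<close>

lemma block_index_less: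
  fixes i p q m :: nat
  assumes "q < p" "i < m"
  shows "q * m + i < p * m"
proof -
  have "q * m + i < Suc q * m" using assms by simp
  also have "\<dots> \<le> p * m" using assms by (intro mult_right_mono) auto
  finally show ?thesis .
qed

lemma block_col_major_bound:
  assumes X: "X \<in> carrier_mat (p * m) (q * n)" and "0 < p" "0 < q"
    and x: "\<And>i j. i < p * m \<Longrightarrow> j < q * n \<Longrightarrow> \<bar>X $$ (i, j)\<bar> \<le> x"
    and "l < p * q" "i < m" "j < n"
  shows "\<bar>block_col_major p q X l $$ (i, j)\<bar> \<le> x"
proof -
  have "l mod p < p" "l div p < q"
    using assms by (simp_all add: less_mult_imp_div_less mult.commute)
  then show ?thesis
    using assms by (auto simp: block_col_major_def block_def intro!: x block_index_less)
qed

text \<open>This inverts the block enumeration by division with remainder; with it, bounds on each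
  output block yield a bound on every entry of the whole matrix.\<close>

lemma block_row_major_entry:
  assumes "X \<in> carrier_mat (p * m) (q * n)" "i < p * m" "j < q * n"
  shows "block_row_major p q X ((i div m) * q + j div n) $$ (i mod m, j mod n) = X $$ (i, j)"
    and "(i div m) * q + j div n < p * q" and "i mod m < m" and "j mod n < n"
proof -
  have p: "0 < p" and m: "0 < m" and q: "0 < q" and n: "0 < n"
    using assms(2,3) by (auto intro!: Nat.gr0I)
  have d: "i div m < p" "j div n < q"
    using assms(2,3) by (simp_all add: less_mult_imp_div_less)
  show "(i div m) * q + j div n < p * q"
    by (rule block_index_less[OF d])
  show "i mod m < m" "j mod n < n" using m n by simp_all
  then show "block_row_major p q X ((i div m) * q + j div n) $$ (i mod m, j mod n) = X $$ (i, j)"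
    using assms(1) p q d by (auto simp: block_row_major_def block_def)
qed

section \<open>Principal quantities of a bilinear algorithm\<close>

lemma a_sum_nonneg: "0 \<le> a_sum F r"
  and b_sum_nonneg: "0 \<le> b_sum F r"
  by (simp_all add: a_sum_def b_sum_def sum_nonneg)

lemma stability_factor_ge:
  assumes "k < base_M F * base_N F"
  shows "(\<Sum>r<rk F. a_sum F r * b_sum F r * \<bar>mat_W F $$ (k, r)\<bar>) \<le> stability_factor F"
  unfolding stability_factor_def using assms by (intro Max_ge) auto

text \<open>The left side is the number of roundings charged to product \<open>r\<close> on its way
  to output block \<open>k\<close>: those in forming its two factors and those in the output sum. A
  nonzero weight makes the indicator in \<open>prefactor\<close> equal to 1.\<close>

lemma prefactor_ge:
  assumes "k < base_M F * base_N F" "r < rk F" "mat_W F $$ (k, r) \<noteq> 0"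
  shows "gamma_count F k + (alpha_count F r + beta_count F r) \<le> prefactor F"
proof -
  have "(alpha_count F r + beta_count F r) * of_bool (mat_W F $$ (k, r) \<noteq> 0) \<le>
    (MAX r \<in> {..<rk F}. (alpha_count F r + beta_count F r) * of_bool (mat_W F $$ (k, r) \<noteq> 0))"
    using assms by (intro Max_ge) auto
  then have "gamma_count F k + (alpha_count F r + beta_count F r) \<le> gamma_count F k +
     (MAX r \<in> {..<rk F}. (alpha_count F r + beta_count F r) * of_bool (mat_W F $$ (k, r) \<noteq> 0))"
    using assms by simp
  also have "\<dots> \<le> prefactor F"
    unfolding prefactor_def using assms(1) by (intro Max_ge) auto
  finally show ?thesis .
qed

lemma bilinear_algorithm_exact:
  assumes "bilinear_algorithm F"
    and "A \<in> carrier_mat (base_M F * p) (base_K F * q)"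
    and "B \<in> carrier_mat (base_K F * q) (base_N F * s)"
    and "k < base_M F * base_N F"
  shows "block_row_major (base_M F) (base_N F) (A * B) k =
    lincomb_mat p s (rk F) (\<lambda>r. mat_W F $$ (k, r))
      (\<lambda>r. lincomb_mat p q (base_M F * base_K F) (\<lambda>i. mat_U F $$ (i, r))
              (block_col_major (base_M F) (base_K F) A) *
            lincomb_mat q s (base_K F * base_N F) (\<lambda>j. mat_V F $$ (j, r))
              (block_col_major (base_K F) (base_N F) B))"
  using assms(1) unfolding bilinear_algorithm_def Let_def
  by (elim conjE allE[of _ p] allE[of _ q] allE[of _ s]) (use assms(2-) in simp)

text \<open>Apply the algorithm to two all-ones matrices: every entry of the product is \<open>base_K F\<close>.\<close>

lemma base_K_le_stability_factor:
  assumes "bilinear_algorithm F"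
  shows "real (base_K F) \<le> stability_factor F"
proof -
  let ?M = "base_M F" and ?K = "base_K F" and ?N = "base_N F"
  define A :: "real mat" where "A = mat ?M ?K (\<lambda>_. 1)"
  define B :: "real mat" where "B = mat ?K ?N (\<lambda>_. 1)"
  define S where "S r = lincomb_mat 1 1 (?M * ?K) (\<lambda>i. mat_U F $$ (i, r))
    (block_col_major ?M ?K A)" for r
  define T where "T r = lincomb_mat 1 1 (?K * ?N) (\<lambda>j. mat_V F $$ (j, r))
    (block_col_major ?K ?N B)" for r
  have pos: "0 < ?M" "0 < ?K" "0 < ?N" using assms by (auto simp: bilinear_algorithm_def)
  \<comment> \<open>Blocks of size one by one turn the block identity into a scalar one. Any output
    index would do; 0 exists because the base dimensions are positive.\<close>
  have "A \<in> carrier_mat (?M * 1) (?K * 1)" "B \<in> carrier_mat (?K * 1) (?N * 1)"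
    by (simp_all add: A_def B_def)
  then have "block_row_major ?M ?N (A * B) 0 =
      lincomb_mat 1 1 (rk F) (\<lambda>r. mat_W F $$ (0, r)) (\<lambda>r. S r * T r)"
    unfolding S_def T_def using assms pos by (intro bilinear_algorithm_exact) auto
  then have eq: "block_row_major ?M ?N (A * B) 0 $$ (0, 0) =
      (\<Sum>r<rk F. mat_W F $$ (0, r) * (S r * T r) $$ (0, 0))"
    by (simp add: lincomb_mat_def)
  have lhs: "block_row_major ?M ?N (A * B) 0 $$ (0, 0) = ?K"
    using pos by (simp add: block_row_major_def block_def A_def B_def scalar_prod_def)
  have S: "\<bar>S r $$ (0, 0)\<bar> \<le> a_sum F r" for r
  proof -
    have "\<bar>block_col_major ?M ?K A l $$ (0, 0)\<bar> \<le> 1" if "l < ?M * ?K" for l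
      by (rule block_col_major_bound[of A _ 1 _ 1]) (use that pos in \<open>auto simp: A_def\<close>)
    then show ?thesis
      by (auto simp: S_def lincomb_mat_def a_sum_def abs_mult
          intro!: order.trans[OF sum_abs] sum_mono mult_left_le)
  qed
  have T: "\<bar>T r $$ (0, 0)\<bar> \<le> b_sum F r" for r
  proof -
    have "\<bar>block_col_major ?K ?N B l $$ (0, 0)\<bar> \<le> 1" if "l < ?K * ?N" for l
      by (rule block_col_major_bound[of B _ 1 _ 1]) (use that pos in \<open>auto simp: B_def\<close>)
    then show ?thesis
      by (auto simp: T_def lincomb_mat_def b_sum_def abs_mult
          intro!: order.trans[OF sum_abs] sum_mono mult_left_le)
  qed
  have "mat_W F $$ (0, r) * (S r * T r) $$ (0, 0)
      \<le> a_sum F r * b_sum F r * \<bar>mat_W F $$ (0, r)\<bar>" for r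
  proof -
    have "(S r * T r) $$ (0, 0) = S r $$ (0, 0) * T r $$ (0, 0)"
      by (simp add: S_def T_def lincomb_mat_def scalar_prod_def)
    then have "\<bar>(S r * T r) $$ (0, 0)\<bar> \<le> a_sum F r * b_sum F r"
      using S T a_sum_nonneg by (simp add: abs_mult mult_mono)
    then have "\<bar>mat_W F $$ (0, r)\<bar> * \<bar>(S r * T r) $$ (0, 0)\<bar>
        \<le> \<bar>mat_W F $$ (0, r)\<bar> * (a_sum F r * b_sum F r)"
      by (intro mult_left_mono) auto
    then show ?thesis by (metis abs_le_D1 abs_mult mult.commute)
  qed
  then have "real ?K \<le> (\<Sum>r<rk F. a_sum F r * b_sum F r * \<bar>mat_W F $$ (0, r)\<bar>)"
    using eq lhs by (simp add: sum_mono)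
  also have "\<dots> \<le> stability_factor F" using pos by (intro stability_factor_ge) auto
  finally show ?thesis .
qed

section \<open>Error propagation through the recursion\<close>

lemma fl_fast_mult_carrier:
  "fl_fast_mult \<epsilon> Fs A B C \<Longrightarrow> C \<in> carrier_mat (dim_row A) (dim_col B)"
  by (cases Fs) (auto simp: fl_classical_def)

lemma abs_sum_mult_bound:
  fixes c x :: "nat \<Rightarrow> real"
  assumes "\<And>l. l < n \<Longrightarrow> \<bar>x l\<bar> \<le> b"
  shows "(\<Sum>l<n. \<bar>c l\<bar> * \<bar>x l\<bar>) \<le> (\<Sum>l<n. \<bar>c l\<bar>) * b"
  unfolding sum_distrib_right using assms by (intro sum_mono mult_left_mono) auto

text \<open>For the input combinations all blocks share one entry bound, so the sum of absolute
  coefficients splits off and becomes \<open>a_sum\<close> or \<open>b_sum\<close>.\<close>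

lemma fl_lincomb_mat_error_bound:
  assumes "0 \<le> \<epsilon>" "fl_lincomb_mat \<epsilon> m n len c X Y" "i < m" "j < n"
    and x: "\<And>l. l < len \<Longrightarrow> \<bar>X l $$ (i, j)\<bar> \<le> x"
  shows "\<bar>Y $$ (i, j) - lincomb_mat m n len c X $$ (i, j)\<bar>
      \<le> ((1 + \<epsilon>) ^ (\<Sum>l<len. of_bool (c l \<noteq> 0)) - 1) * ((\<Sum>l<len. \<bar>c l\<bar>) * x)"
proof -
  have "\<bar>Y $$ (i, j) - lincomb_mat m n len c X $$ (i, j)\<bar>
    \<le> ((1 + \<epsilon>) ^ (\<Sum>l<len. of_bool (c l \<noteq> 0)) - 1) * (\<Sum>l<len. \<bar>c l\<bar> * \<bar>X l $$ (i, j)\<bar>)"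
    using fl_lincomb_mat_error[OF assms(1-4)] assms(3,4) by (simp add: lincomb_mat_def)
  also have "\<dots> \<le> ((1 + \<epsilon>) ^ (\<Sum>l<len. of_bool (c l \<noteq> 0)) - 1) * ((\<Sum>l<len. \<bar>c l\<bar>) * x)"
    using assms(1) x by (intro mult_left_mono abs_sum_mult_bound) (auto simp: one_le_power)
  finally show ?thesis .
qed

lemma lincomb_mat_bound:
  assumes "i < m" "j < n" and x: "\<And>l. l < len \<Longrightarrow> \<bar>X l $$ (i, j)\<bar> \<le> x"
  shows "\<bar>lincomb_mat m n len c X $$ (i, j)\<bar> \<le> (\<Sum>l<len. \<bar>c l\<bar>) * x"
proof -
  have "\<bar>lincomb_mat m n len c X $$ (i, j)\<bar> \<le> (\<Sum>l<len. \<bar>c l\<bar> * \<bar>X l $$ (i, j)\<bar>)"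
    using assms(1,2) by (auto simp: lincomb_mat_def abs_mult intro: order.trans[OF sum_abs])
  also have "\<dots> \<le> (\<Sum>l<len. \<bar>c l\<bar>) * x" using x by (rule abs_sum_mult_bound)
  finally show ?thesis .
qed

text \<open>A natural number, so that it can be an exponent of \<open>1 + \<epsilon>\<close>; the
  division is exact whenever the product of the \<open>base_K\<close> divides
  \<open>K\<close>.\<close>

definition error_power :: "bilinear list \<Rightarrow> nat \<Rightarrow> nat" where
  "error_power Fs K = K div prod_list (map base_K Fs) + sum_list (map prefactor Fs)"

definition error_scale :: "bilinear list \<Rightarrow> nat \<Rightarrow> real" where
  "error_scale Fs K = real (K div prod_list (map base_K Fs)) * prod_list (map stability_factor Fs)"

text \<open>Multiply \<open>base_K_le_stability_factor\<close> over the levels. The inner dimension,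
  which enters through products of perturbed factors, can then be measured on the same scale as the
  recursive error.\<close>

lemma dim_le_error_scale:
  assumes "\<And>F. F \<in> set Fs \<Longrightarrow> bilinear_algorithm F" "prod_list (map base_K Fs) dvd K"
  shows "real K \<le> error_scale Fs K"
proof -
  let ?P = "prod_list (map base_K Fs)"
  have "real ?P \<le> prod_list (map stability_factor Fs)"
    using assms(1)
  proof (induction Fs)
    case (Cons F Fs)
    have "real (base_K F) \<le> stability_factor F"
      using Cons.prems by (intro base_K_le_stability_factor) auto
    moreover have "real (prod_list (map base_K Fs)) \<le> prod_list (map stability_factor Fs)"
      using Cons by auto
    ultimately show ?case by (simp add: mult_mono)
  qed simp
  then have "real (K div ?P) * real ?P \<le> error_scale Fs K"
    unfolding error_scale_def by (intro mult_left_mono) auto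
  moreover have "real (K div ?P) * real ?P = real K"
    using assms(2) by (metis dvd_div_mult_self of_nat_mult)
  ultimately show ?thesis by simp
qed

text \<open>At each level the errors of the input combinations, of the recursive product and of the
  output sum are all of the form (growth - 1) times a common scale, so growths multiply and
  exponents add. Free entry bounds \<open>a\<close> and \<open>b\<close> are used because the
  induction hypothesis is applied to computed factors, whose bounds have grown.\<close>

lemma fl_fast_mult_error:
  assumes "\<And>F. F \<in> set Fs \<Longrightarrow> bilinear_algorithm F" and eps: "0 \<le> \<epsilon>"
    and "prod_list (map base_M Fs) dvd M" "prod_list (map base_K Fs) dvd K"
      "prod_list (map base_N Fs) dvd N"
    and "A \<in> carrier_mat M K" "B \<in> carrier_mat K N" "fl_fast_mult \<epsilon> Fs A B C"
    and "\<And>i j. i < M \<Longrightarrow> j < K \<Longrightarrow> \<bar>A $$ (i, j)\<bar> \<le> a"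
    and "\<And>i j. i < K \<Longrightarrow> j < N \<Longrightarrow> \<bar>B $$ (i, j)\<bar> \<le> b"
    and "0 \<le> a" "0 \<le> b" "i < M" "j < N"
  shows "\<bar>C $$ (i, j) - (A * B) $$ (i, j)\<bar>
    \<le> ((1 + \<epsilon>) ^ error_power Fs K - 1) * (error_scale Fs K * (a * b))"
  using assms(1,3-)
proof (induction Fs arbitrary: M K N A B C a b i j)
  case Nil
  then show ?case
    using fl_classical_error[OF eps, of A B C M K N a b i j]
    by (simp add: error_power_def error_scale_def)
next
  case (Cons F Fs)
  let ?M = "base_M F" and ?K = "base_K F" and ?N = "base_N F"
  have F: "bilinear_algorithm F" and Fs: "\<And>F. F \<in> set Fs \<Longrightarrow> bilinear_algorithm F"
    using Cons.prems(1) by auto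
  have pos: "0 < ?M" "0 < ?K" "0 < ?N" using F by (auto simp: bilinear_algorithm_def)
  define m where "m = M div ?M"
  define h where "h = K div ?K"
  define n where "n = N div ?N"
  have M: "M = ?M * m" and K: "K = ?K * h" and N: "N = ?N * n"
    using Cons.prems(2-4) by (auto simp: m_def h_def n_def dest!: dvd_mult_left)
  have dvd: "prod_list (map base_M Fs) dvd m" "prod_list (map base_K Fs) dvd h"
      "prod_list (map base_N Fs) dvd n"
    using Cons.prems(2-4) pos by (auto simp: M K N)
  define u where "u = (\<lambda>r l. mat_U F $$ (l, r))"
  define v where "v = (\<lambda>r l. mat_V F $$ (l, r))"
  define w where "w = (\<lambda>k r. mat_W F $$ (k, r))"
  define S where "S r = lincomb_mat m h (?M * ?K) (u r) (block_col_major ?M ?K A)" for r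
  define T where "T r = lincomb_mat h n (?K * ?N) (v r) (block_col_major ?K ?N B)" for r
  \<comment> \<open>The scale of the remaining levels for entry bounds \<open>a\<close> and
    \<open>b\<close>; everything about product \<open>r\<close> is bounded by a multiple of
    \<open>a_sum F r * b_sum F r * X\<close>.\<close>
  define X where "X = error_scale Fs h * (a * b)"
  define p where "p = error_power Fs h"
  note A = Cons.prems(5) and B = Cons.prems(6)
  have dims: "dim_row A = M" "dim_col A = K" "dim_row B = K" "dim_col B = N"
    using A B by auto
  from Cons.prems(7) obtain S' T' P where C: "C \<in> carrier_mat M N"
    and S': "\<And>r. r < rk F \<Longrightarrow>
      fl_lincomb_mat \<epsilon> m h (?M * ?K) (u r) (block_col_major ?M ?K A) (S' r)"
    and T': "\<And>r. r < rk F \<Longrightarrow>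
      fl_lincomb_mat \<epsilon> h n (?K * ?N) (v r) (block_col_major ?K ?N B) (T' r)"
    and P: "\<And>r. r < rk F \<Longrightarrow> fl_fast_mult \<epsilon> Fs (S' r) (T' r) (P r)"
    and W: "\<And>k. k < ?M * ?N \<Longrightarrow>
      fl_lincomb_mat \<epsilon> m n (rk F) (w k) P (block_row_major ?M ?N C k)"
    by (auto simp: Let_def dims m_def[symmetric] h_def[symmetric] n_def[symmetric]
        u_def v_def w_def)
  have AB: "A * B \<in> carrier_mat (?M * m) (?N * n)" using A B by (simp add: M N)
  have exact: "block_row_major ?M ?N (A * B) k = lincomb_mat m n (rk F) (w k) (\<lambda>r. S r * T r)"
    if "k < ?M * ?N" for k
    using F A B that unfolding S_def T_def u_def v_def w_def M K N
    by (intro bilinear_algorithm_exact)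
  \<comment> \<open>The only use of the inequality between base dimension and stability factor: it
    absorbs the inner dimension \<open>h\<close> of the subproblem.\<close>
  have hX: "real h * (a * b) \<le> X"
    using dim_le_error_scale[OF Fs dvd(2)] Cons.prems(10,11)
    by (auto simp: X_def intro!: mult_right_mono)
  have X: "0 \<le> X" using hX Cons.prems(10,11) by (smt (verit) mult_nonneg_nonneg of_nat_0_le_iff)
  have one: "1 \<le> (1 + \<epsilon>) ^ q" for q using eps by (simp add: one_le_power)

  have blockA: "\<bar>block_col_major ?M ?K A l $$ (i, j)\<bar> \<le> a"
    if "l < ?M * ?K" "i < m" "j < h" for l i j
    using A Cons.prems(8) pos that by (intro block_col_major_bound) (auto simp: M K)
  have blockB: "\<bar>block_col_major ?K ?N B l $$ (i, j)\<bar> \<le> b"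
    if "l < ?K * ?N" "i < h" "j < n" for l i j
    using B Cons.prems(9) pos that by (intro block_col_major_bound) (auto simp: K N)

  have product: "\<bar>P r $$ (i, j) - (S r * T r) $$ (i, j)\<bar>
        \<le> ((1 + \<epsilon>) ^ (alpha_count F r + beta_count F r + p) - 1) * (a_sum F r * b_sum F r * X)"
    and exact_product: "\<bar>(S r * T r) $$ (i, j)\<bar> \<le> a_sum F r * b_sum F r * X"
    if r: "r < rk F" and ij: "i < m" "j < n" for r i j
  proof -
    define x where "x = (1 + \<epsilon>) ^ alpha_count F r"
    define y where "y = (1 + \<epsilon>) ^ beta_count F r"
    define a' where "a' = a_sum F r * a"
    define b' where "b' = b_sum F r * b"
    have x: "1 \<le> x" and y: "1 \<le> y" by (simp_all add: x_def y_def one)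
    have a': "0 \<le> a'" and b': "0 \<le> b'"
      using Cons.prems(10,11) by (simp_all add: a'_def b'_def a_sum_nonneg b_sum_nonneg)
    have S'_err: "\<bar>S' r $$ (i, j) - S r $$ (i, j)\<bar> \<le> (x - 1) * a'"
      and S_bd: "\<bar>S r $$ (i, j)\<bar> \<le> a'" if "i < m" "j < h" for i j
      using fl_lincomb_mat_error_bound[OF eps S'[OF r], of i j a] that blockA
        lincomb_mat_bound[of i m j h "?M * ?K" "block_col_major ?M ?K A" a "u r"]
      by (simp_all add: S_def x_def a'_def u_def alpha_count_def a_sum_def)
    have T'_err: "\<bar>T' r $$ (i, j) - T r $$ (i, j)\<bar> \<le> (y - 1) * b'"
      and T_bd: "\<bar>T r $$ (i, j)\<bar> \<le> b'" if "i < h" "j < n" for i j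
      using fl_lincomb_mat_error_bound[OF eps T'[OF r], of i j b] that blockB
        lincomb_mat_bound[of i h j n "?K * ?N" "block_col_major ?K ?N B" b "v r"]
      by (simp_all add: T_def y_def b'_def v_def beta_count_def b_sum_def)
    \<comment> \<open>Computed factors exceed the bounds of the exact ones by \<open>x\<close> and
      \<open>y\<close> at most; these are the entry bounds fed to the induction hypothesis.\<close>
    have S'_bd: "\<bar>S' r $$ (i, j)\<bar> \<le> x * a'" if "i < m" "j < h" for i j
      using S'_err[OF that] S_bd[OF that] by (simp add: algebra_simps)
    have T'_bd: "\<bar>T' r $$ (i, j)\<bar> \<le> y * b'" if "i < h" "j < n" for i j
      using T'_err[OF that] T_bd[OF that] by (simp add: algebra_simps)
    have carrier: "S r \<in> carrier_mat m h" "T r \<in> carrier_mat h n"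
        "S' r \<in> carrier_mat m h" "T' r \<in> carrier_mat h n"
      using S'[OF r] T'[OF r] by (simp_all add: S_def T_def lincomb_mat_def fl_lincomb_mat_def)
    have hX': "real h * (a' * b') \<le> a_sum F r * b_sum F r * X"
    proof -
      have "real h * (a' * b') = a_sum F r * b_sum F r * (real h * (a * b))"
        by (simp add: a'_def b'_def)
      also have "\<dots> \<le> a_sum F r * b_sum F r * X"
        using hX by (intro mult_left_mono) (auto simp: a_sum_nonneg b_sum_nonneg)
      finally show ?thesis .
    qed
    show "\<bar>(S r * T r) $$ (i, j)\<bar> \<le> a_sum F r * b_sum F r * X"
      using mult_mat_bound[OF carrier(1,2) S_bd T_bd ij] hX' by simp
    have xy: "1 \<le> x * y" using x y by (metis mult_mono' mult_1 zero_le_one)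
    have "\<bar>(S' r * T' r) $$ (i, j) - (S r * T r) $$ (i, j)\<bar> \<le> h * ((x * y - 1) * (a' * b'))"
      by (rule mult_mat_error[OF carrier x y S_bd T_bd S'_err T'_err ij])
    also have "\<dots> = (x * y - 1) * (h * (a' * b'))" by simp
    also have "\<dots> \<le> (x * y - 1) * (a_sum F r * b_sum F r * X)"
      using hX' xy by (intro mult_left_mono) auto
    finally have e1: "\<bar>(S' r * T' r) $$ (i, j) - (S r * T r) $$ (i, j)\<bar>
      \<le> (x * y - 1) * (a_sum F r * b_sum F r * X)" .
    \<comment> \<open>The recursion multiplies the computed factors, so its error is relative to
      \<open>S' r * T' r\<close>; the distance from there to \<open>S r * T r\<close> is the
      preceding bound.\<close>
    have "\<bar>P r $$ (i, j) - (S' r * T' r) $$ (i, j)\<bar>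
      \<le> ((1 + \<epsilon>) ^ p - 1) * (error_scale Fs h * ((x * a') * (y * b')))"
      unfolding p_def
      using x y a' b' by (intro Cons.IH[OF Fs dvd carrier(3,4) P[OF r] S'_bd T'_bd _ _ ij]) auto
    also have "\<dots> = ((1 + \<epsilon>) ^ p - 1) * (x * y) * (a_sum F r * b_sum F r * X)"
      by (simp add: X_def a'_def b'_def)
    finally have "\<bar>P r $$ (i, j) - (S r * T r) $$ (i, j)\<bar>
      \<le> ((1 + \<epsilon>) ^ p - 1) * (x * y) * (a_sum F r * b_sum F r * X)
        + (x * y - 1) * (a_sum F r * b_sum F r * X)"
      using e1 by linarith
    \<comment> \<open>The two errors telescope:
      \<open>(z - 1) * (x * y) + (x * y - 1) = x * y * z - 1\<close> for
      \<open>z = (1 + \<epsilon>) ^ p\<close>.\<close>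
    also have "\<dots> = (x * y * (1 + \<epsilon>) ^ p - 1) * (a_sum F r * b_sum F r * X)"
      by (simp add: algebra_simps)
    finally show "\<bar>P r $$ (i, j) - (S r * T r) $$ (i, j)\<bar>
        \<le> ((1 + \<epsilon>) ^ (alpha_count F r + beta_count F r + p) - 1) * (a_sum F r * b_sum F r * X)"
      by (simp add: x_def y_def power_add)
  qed

  \<comment> \<open>The output block containing entry \<open>(i, j)\<close>, and the position of the
    entry in it.\<close>
  define k where "k = (i div m) * ?N + j div n"
  define i' where "i' = i mod m"
  define j' where "j' = j mod n"
  have C': "C \<in> carrier_mat (?M * m) (?N * n)" and ij: "i < ?M * m" "j < ?N * n"
    using C Cons.prems(12,13) M N by auto
  note entry = block_row_major_entry[OF C' ij, folded k_def i'_def j'_def]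
    block_row_major_entry(1)[OF AB ij, folded k_def i'_def j'_def]
  have k: "k < ?M * ?N" and i': "i' < m" and j': "j' < n" using entry by auto
  have AB_ij: "(A * B) $$ (i, j) = (\<Sum>r<rk F. w k r * (S r * T r) $$ (i', j'))"
    using entry(5) i' j' by (simp add: exact[OF k] lincomb_mat_def)
  let ?g = "(1 + \<epsilon>) ^ gamma_count F k"
  \<comment> \<open>The comparison value is the exact weighted sum of the computed products:
    rounding of the output sum on one side, inherited errors of the products on the other.\<close>
  have "\<bar>C $$ (i, j) - (\<Sum>r<rk F. w k r * P r $$ (i', j'))\<bar>
      \<le> (?g - 1) * (\<Sum>r<rk F. \<bar>w k r\<bar> * \<bar>P r $$ (i', j')\<bar>)"
    using fl_lincomb_mat_error[OF eps W[OF k] i' j'] entry(1)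
    by (simp add: gamma_count_def w_def)
  moreover have "\<bar>(\<Sum>r<rk F. w k r * P r $$ (i', j')) - (A * B) $$ (i, j)\<bar>
      \<le> (\<Sum>r<rk F. \<bar>w k r\<bar> * \<bar>P r $$ (i', j') - (S r * T r) $$ (i', j')\<bar>)"
    unfolding AB_ij
    by (auto simp: sum_subtractf[symmetric] right_diff_distrib[symmetric] abs_mult
        intro: order.trans[OF sum_abs])
  ultimately have "\<bar>C $$ (i, j) - (A * B) $$ (i, j)\<bar> \<le> (\<Sum>r<rk F. \<bar>w k r\<bar> *
      ((?g - 1) * \<bar>P r $$ (i', j')\<bar> + \<bar>P r $$ (i', j') - (S r * T r) $$ (i', j')\<bar>))"
    by (simp add: distrib_left sum.distrib sum_distrib_left mult.left_commute)
  also have "\<dots> \<le> (\<Sum>r<rk F. \<bar>w k r\<bar> *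
      (((1 + \<epsilon>) ^ (prefactor F + p) - 1) * (a_sum F r * b_sum F r * X)))"
  proof (rule sum_mono)
    fix r assume "r \<in> {..<rk F}"
    then have r: "r < rk F" by simp
    let ?z = "(1 + \<epsilon>) ^ (alpha_count F r + beta_count F r + p)"
    let ?D = "\<bar>P r $$ (i', j') - (S r * T r) $$ (i', j')\<bar>"
    let ?Y = "a_sum F r * b_sum F r * X"
    show "\<bar>w k r\<bar> * ((?g - 1) * \<bar>P r $$ (i', j')\<bar> + ?D)
      \<le> \<bar>w k r\<bar> * (((1 + \<epsilon>) ^ (prefactor F + p) - 1) * ?Y)"
    \<comment> \<open>\<open>prefactor\<close> dominates the exponent of product \<open>r\<close>
      only if its weight is nonzero; for zero weight both sides vanish.\<close>
    proof (cases "w k r = 0")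
      case False
      have Y: "0 \<le> ?Y" using X by (simp add: a_sum_nonneg b_sum_nonneg)
      have D: "?D \<le> (?z - 1) * ?Y" by (rule product[OF r i' j'])
      have "\<bar>P r $$ (i', j')\<bar> \<le> ?z * ?Y"
        using D exact_product[OF r i' j'] by (simp add: algebra_simps)
      then have "(?g - 1) * \<bar>P r $$ (i', j')\<bar> + ?D \<le> (?g - 1) * (?z * ?Y) + (?z - 1) * ?Y"
        using D one[of "gamma_count F k"] by (intro add_mono mult_left_mono) auto
      also have "\<dots> = ((1 + \<epsilon>) ^ (gamma_count F k + (alpha_count F r + beta_count F r) + p) - 1)
          * ?Y"
        by (simp add: algebra_simps power_add)
      also have "\<dots> \<le> ((1 + \<epsilon>) ^ (prefactor F + p) - 1) * ?Y"
        using prefactor_ge[OF k r] False Y eps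
        by (intro mult_right_mono diff_right_mono power_increasing) (auto simp: w_def)
      finally show ?thesis by (intro mult_left_mono) auto
    qed simp
  qed
  also have "\<dots> = ((1 + \<epsilon>) ^ (prefactor F + p) - 1) *
      (X * (\<Sum>r<rk F. a_sum F r * b_sum F r * \<bar>mat_W F $$ (k, r)\<bar>))"
    by (simp add: sum_distrib_left w_def mult_ac)
  also have "\<dots> \<le> ((1 + \<epsilon>) ^ (prefactor F + p) - 1) * (X * stability_factor F)"
    using stability_factor_ge[OF k] X one[of "prefactor F + p"] by (intro mult_left_mono) auto
  \<comment> \<open>Dividing \<open>K\<close> by \<open>base_K F\<close> and then by the remaining
    base dimensions equals dividing by their product, so subproblem and whole problem have the same
    base-case dimension.\<close>
  also have "prefactor F + p = error_power (F # Fs) K"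
    by (simp add: p_def error_power_def h_def div_mult2_eq)
  also have "X * stability_factor F = error_scale (F # Fs) K * (a * b)"
    by (simp add: X_def error_scale_def h_def div_mult2_eq)
  finally show ?case .
qed

section \<open>Max-norm and the linear part of the bound\<close>

lemma max_norm_ge:
  assumes "i < dim_row X" "j < dim_col X"
  shows "\<bar>X $$ (i, j)\<bar> \<le> max_norm X"
proof -
  have "{\<bar>X $$ (i, j)\<bar> | i j. i < dim_row X \<and> j < dim_col X}
    = (\<lambda>(i, j). \<bar>X $$ (i, j)\<bar>) ` ({..<dim_row X} \<times> {..<dim_col X})" by auto
  then show ?thesis unfolding max_norm_def using assms by (intro Max_ge) auto
qed

text \<open>Positive dimensions make the set of absolute values nonempty, as an upper bound on
  \<open>Max\<close> requires.\<close>

lemma max_norm_le: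
  assumes "0 < dim_row X" "0 < dim_col X"
    and "\<And>i j. i < dim_row X \<Longrightarrow> j < dim_col X \<Longrightarrow> \<bar>X $$ (i, j)\<bar> \<le> x"
  shows "max_norm X \<le> x"
proof -
  have "{\<bar>X $$ (i, j)\<bar> | i j. i < dim_row X \<and> j < dim_col X}
    = (\<lambda>(i, j). \<bar>X $$ (i, j)\<bar>) ` ({..<dim_row X} \<times> {..<dim_col X})" by auto
  then show ?thesis unfolding max_norm_def using assms by (subst Max_le_iff) auto
qed

text \<open>The remainders satisfy
  \<open>r (Suc p) = (1 + \<epsilon>) * r p + p * \<epsilon>\<^sup>2\<close>, and
  \<open>1 + \<epsilon>\<close> is bounded near 0.\<close>

lemma one_plus_power_remainder_bigo:
  "(\<lambda>\<epsilon>::real. (1 + \<epsilon>) ^ p - 1 - p * \<epsilon>) \<in> O[at_right 0](\<lambda>\<epsilon>. \<epsilon>\<^sup>2)"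
proof (induction p)
  case (Suc p)
  have "(\<lambda>\<epsilon>::real. 1 + \<epsilon>) \<in> O[at_right 0](\<lambda>_. 1)"
    by (rule bigoI_tendsto[where c = 1]) (auto intro!: tendsto_eq_intros)
  then have "(\<lambda>\<epsilon>::real. (1 + \<epsilon>) * ((1 + \<epsilon>) ^ p - 1 - p * \<epsilon>)) \<in> O[at_right 0](\<lambda>\<epsilon>. 1 * \<epsilon>\<^sup>2)"
    by (intro landau_o.big.mult Suc)
  then have "(\<lambda>\<epsilon>::real. (1 + \<epsilon>) * ((1 + \<epsilon>) ^ p - 1 - p * \<epsilon>) + p * \<epsilon>\<^sup>2) \<in> O[at_right 0](\<lambda>\<epsilon>. \<epsilon>\<^sup>2)"
    by (intro sum_in_bigo) auto
  then show ?case by (simp add: algebra_simps power2_eq_square)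
qed simp

theorem theorem4p5:
  fixes L M K N :: nat and alg :: "nat \<Rightarrow> bilinear" and norm_A norm_B :: real
  assumes "\<And>l. l \<in> {1..L} \<Longrightarrow> bilinear_algorithm (alg l)"
    and "0 < M" and "0 < K" and "0 < N"
    and "(\<Prod>l=1..L. base_M (alg l)) dvd M"
    and "(\<Prod>l=1..L. base_K (alg l)) dvd K"
    and "(\<Prod>l=1..L. base_N (alg l)) dvd N"
  shows "\<exists>g :: real \<Rightarrow> real. g \<in> O[at_right 0](\<lambda>\<epsilon>. \<epsilon>\<^sup>2) \<and>
    (\<forall>\<epsilon> > 0. \<forall>A \<in> carrier_mat M K. \<forall>B \<in> carrier_mat K N. \<forall>C_hat.
       max_norm A = norm_A \<and> max_norm B = norm_B \<and>
       fl_fast_mult \<epsilon> (map alg [1..<L + 1]) A B C_hat \<longrightarrow>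
       max_norm (C_hat - A * B) \<le>
         (real K / (\<Prod>l=1..L. real (base_K (alg l))) + (\<Sum>l=1..L. real (prefactor (alg l)))) *
         (real K / (\<Prod>l=1..L. real (base_K (alg l)))) *
         (\<Prod>l=1..L. stability_factor (alg l)) * max_norm A * max_norm B * \<epsilon> + g \<epsilon>)"
proof -
  let ?Fs = "map alg [1..<L + 1]"
  define H where "H = real K / (\<Prod>l=1..L. real (base_K (alg l)))"
  define Q where "Q = (\<Sum>l=1..L. real (prefactor (alg l)))"
  define E where "E = (\<Prod>l=1..L. stability_factor (alg l))"
  define p where "p = error_power ?Fs K"
  define Z where "Z = error_scale ?Fs K * (norm_A * norm_B)"
  \<comment> \<open>What remains of the bound once its linear part is removed. It depends on the
    matrices only through \<open>norm_A\<close> and \<open>norm_B\<close>, so one \<open>g\<close>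
    serves all inputs with these norms.\<close>
  define g where "g \<epsilon> = Z * ((1 + \<epsilon>) ^ p - 1 - p * \<epsilon>)" for \<epsilon> :: real
  \<comment> \<open>Polymorphic, since it is applied both to the natural base dimensions and to the
    real stability factors.\<close>
  have prods: "prod_list (map f ?Fs) = (\<Prod>l=1..L. f (alg l))"
    for f :: "bilinear \<Rightarrow> 'a::comm_monoid_mult"
    by (simp add: o_def prod.distinct_set_conv_list[symmetric] atLeastLessThanSuc_atLeastAtMost
        del: upt_Suc)
  have sums: "sum_list (map f ?Fs) = (\<Sum>l=1..L. f (alg l))" for f :: "bilinear \<Rightarrow> nat"
    by (simp add: o_def sum.distinct_set_conv_list[symmetric] atLeastLessThanSuc_atLeastAtMost
        del: upt_Suc)
  have H: "real (K div prod_list (map base_K ?Fs)) = H"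
    unfolding prods H_def using assms(6) by (simp add: real_of_nat_div)
  have p: "real p = H + Q"
    by (simp only: p_def error_power_def of_nat_add H sums Q_def of_nat_sum)
  have Z: "Z = H * E * (norm_A * norm_B)"
    unfolding Z_def error_scale_def H by (simp only: prods E_def)
  have alg: "\<And>F. F \<in> set ?Fs \<Longrightarrow> bilinear_algorithm F" using assms(1) by auto
  have dvd: "prod_list (map base_M ?Fs) dvd M" "prod_list (map base_K ?Fs) dvd K"
      "prod_list (map base_N ?Fs) dvd N"
    unfolding prods by (fact assms)+
  have "g \<in> O[at_right 0](\<lambda>\<epsilon>. \<epsilon>\<^sup>2)"
    \<comment> \<open>A nonzero constant factor cancels in the Landau class; for
      \<open>Z = 0\<close> the function \<open>g\<close> is zero.\<close>
    unfolding g_def by (cases "Z = 0") (simp_all add: one_plus_power_remainder_bigo)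
  moreover have "max_norm (C - A * B) \<le> (H + Q) * H * E * max_norm A * max_norm B * \<epsilon> + g \<epsilon>"
    if "0 < \<epsilon>" and A: "A \<in> carrier_mat M K" and B: "B \<in> carrier_mat K N"
      and norms: "max_norm A = norm_A" "max_norm B = norm_B"
      and C: "fl_fast_mult \<epsilon> ?Fs A B C" for \<epsilon> A B C
  proof -
    have C_carrier: "C \<in> carrier_mat M N" using fl_fast_mult_carrier[OF C] A B by simp
    have a: "\<bar>A $$ (i, j)\<bar> \<le> norm_A" if "i < M" "j < K" for i j
      using max_norm_ge[of i A j] A that norms by auto
    have b: "\<bar>B $$ (i, j)\<bar> \<le> norm_B" if "i < K" "j < N" for i j
      using max_norm_ge[of i B j] B that norms by auto
    \<comment> \<open>Read off at entry \<open>(0, 0)\<close>, which exists because the dimensions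
      are positive.\<close>
    have "0 \<le> norm_A" "0 \<le> norm_B"
      using a[of 0 0] b[of 0 0] assms(2-4) by linarith+
    then have "\<bar>(C - A * B) $$ (i, j)\<bar> \<le> ((1 + \<epsilon>) ^ p - 1) * Z" if "i < M" "j < N" for i j
      using fl_fast_mult_error[OF alg _ dvd A B C a b _ _ that] \<open>0 < \<epsilon>\<close> A B C_carrier that
      by (simp add: p_def Z_def)
    then have "max_norm (C - A * B) \<le> ((1 + \<epsilon>) ^ p - 1) * Z"
      using A B C_carrier assms(2,4) by (intro max_norm_le) auto
    also have "\<dots> = real p * Z * \<epsilon> + g \<epsilon>" by (simp add: g_def algebra_simps)
    also have "\<dots> = (H + Q) * H * E * max_norm A * max_norm B * \<epsilon> + g \<epsilon>"
      by (simp add: p Z norms)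
    finally show ?thesis .
  qed
  ultimately show ?thesis unfolding H_def Q_def E_def by blast
qed

end
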